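(* For quadruples $X_i=(A_i,B_i,P_i,Q_i)$ of matrices in $\mathbb{C}^{n\times n}$, define, whenever $Q_a-P_b$ is invertible, $\Delta_{a,b}=(Q_a-P_b)^{-1}$ and $$F(X_a,X_b)=\begin{bmatrix} A_b\Delta_{a,b}A_a\\ B_a\Delta_{a,b}B_b\\ P_a+B_a\Delta_{a,b}A_a\\ Q_b-A_b\Delta_{a,b}B_b\end{bmatrix}.$$ Then for all quadruples $X_a,X_b,X_c$ for which all the expressions involved are well-defined, $$F(F(X_a,X_b),X_c)=F(X_a,F(X_b,X_c)).$$
   Context: A quadruple $(A,B,P,Q)$ of $n\times n$ complex matrices is identified with the stacked block column with blocks $A,B,P,Q$ in this order; $F(X_a,X_b)$ is again such a quadruple. Writing $X_d=F(X_a,X_b)=(A_d,B_d,P_d,Q_d)$ and $X_e=F(X_b,X_c)=(A_e,B_e,P_e,Q_e)$, "well-defined" means that $Q_a-P_b$, $Q_b-P_c$, $Q_a-P_e$ and $Q_d-P_c$ are all invertible. *)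

theory Defs
  imports "HOL-Analysis.Analysis"
begin

type_synonym 'n cmat = "complex ^ 'n ^ 'n"

text \<open>The blocks \<open>(A, B, P, Q)\<close> of a stacked block column, from top to bottom.\<close>

type_synonym 'n quadruple = "'n cmat \<times> 'n cmat \<times> 'n cmat \<times> 'n cmat"

fun blkP :: "'n::finite quadruple \<Rightarrow> 'n cmat" where
  "blkP (A, B, P, Q) = P"

fun blkQ :: "'n::finite quadruple \<Rightarrow> 'n cmat" where
  "blkQ (A, B, P, Q) = Q"

definition F_defined :: "'n::finite quadruple \<Rightarrow> 'n quadruple \<Rightarrow> bool" where
  "F_defined Xa Xb \<longleftrightarrow> invertible (blkQ Xa - blkP Xb)"

definition \<Delta> :: "'n::finite quadruple \<Rightarrow> 'n quadruple \<Rightarrow> 'n cmat" where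
  "\<Delta> Xa Xb = matrix_inv (blkQ Xa - blkP Xb)"

text \<open>
  The operation is partial. Since \<open>matrix_inv\<close> is total, the value of \<open>F\<close> is
  meaningful only when \<open>F_defined\<close> holds for its arguments.
\<close>

fun F :: "'n::finite quadruple \<Rightarrow> 'n quadruple \<Rightarrow> 'n quadruple" where
  "F (Aa, Ba, Pa, Qa) (Ab, Bb, Pb, Qb) =
    (let D = \<Delta> (Aa, Ba, Pa, Qa) (Ab, Bb, Pb, Qb) in
      (Ab ** D ** Aa,
       Ba ** D ** Bb,
       Pa + Ba ** D ** Aa,
       Qb - Ab ** D ** Bb))"

end

theory Submission imports Defs
begin

text \<open>
  Associativity is a statement about Schur complements. Put \<open>S = Q\<^sub>a - P\<^sub>b\<close>
  and \<open>T = Q\<^sub>b - P\<^sub>c\<close>. The inner products on the two sides invert \<open>S\<close>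
  and \<open>T\<close>, and the outer ones invert \<open>Q\<^sub>d - P\<^sub>c = T - A\<^sub>b S\<inverse> B\<^sub>b\<close> and
  \<open>Q\<^sub>a - P\<^sub>e = S - B\<^sub>b T\<inverse> A\<^sub>b\<close>, which are the two Schur complements of the
  block matrix with rows \<open>(S, B\<^sub>b)\<close> and \<open>(A\<^sub>b, T)\<close>. Apart from the
  summands \<open>P\<^sub>a\<close> and \<open>Q\<^sub>c\<close>, which both sides share, each component is a block
  of the inverse of that matrix, up to sign, multiplied on the left and on the right by
  blocks of \<open>X\<^sub>a\<close> and \<open>X\<^sub>c\<close>. One side computes that inverse by eliminating
  \<open>S\<close> first, the other by eliminating \<open>T\<close> first. The off-diagonal blocks agree
  by \<open>schur_push_through\<close>, the diagonal ones by \<open>schur_inverse_expand\<close>.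
  Exchanging \<open>(S, B\<^sub>b)\<close> with \<open>(T, A\<^sub>b)\<close> exchanges the two complements, so
  each lemma serves twice.
\<close>

lemma matrix_diff_ldistrib:
  fixes A :: "'a::ring_1 ^ 'n ^ 'm" and B C :: "'a ^ 'p ^ 'n"
  shows "A ** (B - C) = A ** B - A ** C"
  by (vector matrix_matrix_mult_def sum_subtractf right_diff_distrib)

lemma matrix_diff_rdistrib:
  fixes A B :: "'a::ring_1 ^ 'n ^ 'm" and C :: "'a ^ 'p ^ 'n"
  shows "(A - B) ** C = A ** C - B ** C"
  by (vector matrix_matrix_mult_def sum_subtractf left_diff_distrib)

lemma matrix_add_rdistrib:
  fixes A B :: "'a::semiring_1 ^ 'n ^ 'm" and C :: "'a ^ 'p ^ 'n"
  shows "(A + B) ** C = A ** C + B ** C"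
  by (vector matrix_matrix_mult_def sum.distrib distrib_right)

lemma matrix_inv_right:
  fixes A :: "'a::semiring_1 ^ 'n ^ 'm"
  assumes "invertible A"
  shows "A ** matrix_inv A = mat 1"
  using someI_ex[OF assms[unfolded invertible_def]] by (simp add: matrix_inv_def)

lemma matrix_inv_left:
  fixes A :: "'a::semiring_1 ^ 'n ^ 'm"
  assumes "invertible A"
  shows "matrix_inv A ** A = mat 1"
  using someI_ex[OF assms[unfolded invertible_def]] by (simp add: matrix_inv_def)

text \<open>
  Both sides come from \<open>(T - A S\<inverse> B) T\<inverse> A = A S\<inverse> (S - B T\<inverse> A)\<close>, where each
  product is \<open>A - A S\<inverse> B T\<inverse> A\<close>, by cancelling the two complements.
\<close>

lemma schur_push_through:
  fixes S :: "'a::ring_1 ^ 'n ^ 'n" and T :: "'a ^ 'm ^ 'm"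
    and A :: "'a ^ 'n ^ 'm" and B :: "'a ^ 'm ^ 'n"
  assumes S: "invertible S" and T: "invertible T"
    and U: "invertible (S - B ** matrix_inv T ** A)"
    and V: "invertible (T - A ** matrix_inv S ** B)"
  shows "matrix_inv (T - A ** matrix_inv S ** B) ** A ** matrix_inv S
       = matrix_inv T ** A ** matrix_inv (S - B ** matrix_inv T ** A)"
proof -
  define U where "U = S - B ** matrix_inv T ** A"
  define V where "V = T - A ** matrix_inv S ** B"
  have UU: "U ** matrix_inv U = mat 1" and VV: "matrix_inv V ** V = mat 1"
    using U V by (simp_all add: U_def V_def matrix_inv_right matrix_inv_left)
  have "V ** (matrix_inv T ** A) = A ** matrix_inv S ** U"
  proof -
    have "V ** (matrix_inv T ** A)
        = (T ** matrix_inv T) ** A - A ** matrix_inv S ** B ** matrix_inv T ** A"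
      by (simp add: V_def matrix_diff_rdistrib matrix_mul_assoc)
    also have "\<dots> = A ** (matrix_inv S ** S) - A ** matrix_inv S ** B ** matrix_inv T ** A"
      by (simp add: S T matrix_inv_right matrix_inv_left)
    also have "\<dots> = A ** matrix_inv S ** U"
      by (simp add: U_def matrix_diff_ldistrib matrix_mul_assoc)
    finally show ?thesis .
  qed
  then have "matrix_inv V ** (V ** (matrix_inv T ** A)) ** matrix_inv U
      = matrix_inv V ** (A ** matrix_inv S ** U) ** matrix_inv U"
    by simp
  then have "(matrix_inv V ** V) ** (matrix_inv T ** A ** matrix_inv U)
      = (matrix_inv V ** A ** matrix_inv S) ** (U ** matrix_inv U)"
    by (simp only: matrix_mul_assoc)
  then show ?thesis
    by (simp add: UU VV flip: U_def V_def)
qed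

text \<open>
  With \<open>U = S - B T\<inverse> A\<close>, pushing through turns the right-hand side into
  \<open>U\<inverse> (U + B T\<inverse> A) S\<inverse>\<close>, and the bracket is \<open>S\<close>.
\<close>

lemma schur_inverse_expand:
  fixes S :: "'a::ring_1 ^ 'n ^ 'n" and T :: "'a ^ 'm ^ 'm"
    and A :: "'a ^ 'n ^ 'm" and B :: "'a ^ 'm ^ 'n"
  assumes S: "invertible S" and T: "invertible T"
    and U: "invertible (S - B ** matrix_inv T ** A)"
    and V: "invertible (T - A ** matrix_inv S ** B)"
  shows "matrix_inv (S - B ** matrix_inv T ** A) = matrix_inv S
       + matrix_inv S ** B ** matrix_inv (T - A ** matrix_inv S ** B) ** A ** matrix_inv S"
proof -
  define U where "U = S - B ** matrix_inv T ** A"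
  define V where "V = T - A ** matrix_inv S ** B"
  have UU: "matrix_inv U ** U = mat 1"
    using U by (simp add: U_def matrix_inv_left)
  have "matrix_inv S + matrix_inv S ** B ** matrix_inv V ** A ** matrix_inv S
      = (matrix_inv U ** U) ** matrix_inv S
        + matrix_inv U ** B ** matrix_inv T ** A ** matrix_inv S"
    using schur_push_through[OF T S V U] by (simp add: UU flip: U_def V_def)
  also have "\<dots> = matrix_inv U ** (U + B ** matrix_inv T ** A) ** matrix_inv S"
    by (simp add: matrix_add_ldistrib matrix_add_rdistrib matrix_mul_assoc)
  also have "\<dots> = matrix_inv U ** (S ** matrix_inv S)"
    by (simp add: U_def matrix_mul_assoc)
  also have "\<dots> = matrix_inv U"
    by (simp add: S matrix_inv_right)
  finally show ?thesis
    by (simp add: U_def V_def)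
qed

theorem theorem4p1:
  fixes Xa Xb Xc :: "'n::finite quadruple"
  assumes "F_defined Xa Xb"
    and "F_defined Xb Xc"
    and "F_defined Xa (F Xb Xc)"
    and "F_defined (F Xa Xb) Xc"
  shows "F (F Xa Xb) Xc = F Xa (F Xb Xc)"
proof -
  obtain Aa Ba Pa Qa where Xa: "Xa = (Aa, Ba, Pa, Qa)" by (cases Xa)
  obtain Ab Bb Pb Qb where Xb: "Xb = (Ab, Bb, Pb, Qb)" by (cases Xb)
  obtain Ac Bc Pc Qc where Xc: "Xc = (Ac, Bc, Pc, Qc)" by (cases Xc)
  define S where "S = Qa - Pb"
  define T where "T = Qb - Pc"
  define U where "U = S - Bb ** matrix_inv T ** Ab"
  define V where "V = T - Ab ** matrix_inv S ** Bb"
  have outer: "Qa - (Pb + Bb ** matrix_inv T ** Ab) = U"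
    "Qb - Ab ** matrix_inv S ** Bb - Pc = V"
    by (simp_all add: U_def V_def S_def T_def algebra_simps)
  have inv: "invertible S" "invertible T"
    "invertible (S - Bb ** matrix_inv T ** Ab)" "invertible (T - Ab ** matrix_inv S ** Bb)"
    using assms outer
    by (simp_all add: Xa Xb Xc F_defined_def \<Delta>_def Let_def U_def V_def flip: S_def T_def)
  have lhs: "F (F Xa Xb) Xc =
     (Ac ** matrix_inv V ** (Ab ** matrix_inv S ** Aa),
      Ba ** matrix_inv S ** Bb ** matrix_inv V ** Bc,
      Pa + Ba ** matrix_inv S ** Aa
        + Ba ** matrix_inv S ** Bb ** matrix_inv V ** (Ab ** matrix_inv S ** Aa),
      Qc - Ac ** matrix_inv V ** Bc)"
    by (simp add: Xa Xb Xc \<Delta>_def Let_def outer flip: S_def T_def)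
  have rhs: "F Xa (F Xb Xc) =
     (Ac ** matrix_inv T ** Ab ** matrix_inv U ** Aa,
      Ba ** matrix_inv U ** (Bb ** matrix_inv T ** Bc),
      Pa + Ba ** matrix_inv U ** Aa,
      Qc - Ac ** matrix_inv T ** Bc
        - Ac ** matrix_inv T ** Ab ** matrix_inv U ** (Bb ** matrix_inv T ** Bc))"
    by (simp add: Xa Xb Xc \<Delta>_def Let_def outer flip: S_def T_def)
  \<comment> \<open>The four blocks of the inverse; reordering \<open>inv\<close> exchanges \<open>S\<close> with \<open>T\<close>.\<close>
  have "Ac ** (matrix_inv V ** Ab ** matrix_inv S) ** Aa
      = Ac ** (matrix_inv T ** Ab ** matrix_inv U) ** Aa"
    using schur_push_through[OF inv] by (simp flip: U_def V_def)
  moreover have "Ba ** (matrix_inv S ** Bb ** matrix_inv V) ** Bc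
      = Ba ** (matrix_inv U ** Bb ** matrix_inv T) ** Bc"
    using schur_push_through[OF inv(2,1,4,3)] by (simp flip: U_def V_def)
  moreover have "Ba ** matrix_inv U ** Aa
      = Ba ** (matrix_inv S + matrix_inv S ** Bb ** matrix_inv V ** Ab ** matrix_inv S) ** Aa"
    using schur_inverse_expand[OF inv] by (simp flip: U_def V_def)
  moreover have "Ac ** matrix_inv V ** Bc
      = Ac ** (matrix_inv T + matrix_inv T ** Ab ** matrix_inv U ** Bb ** matrix_inv T) ** Bc"
    using schur_inverse_expand[OF inv(2,1,4,3)] by (simp flip: U_def V_def)
  ultimately show ?thesis
    by (simp add: lhs rhs matrix_add_ldistrib matrix_add_rdistrib matrix_mul_assoc add.assoc
        diff_diff_eq)
qed

end
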